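(* Let $q$ be a power of $2$, let $g\in \mathrm{U}(n,\mathbb{F}_q)$, and let $\mu$ be the partition corresponding to the elementary divisors of $g$ of the form $(t-1)^{\mu_i}$. Suppose that one of the following holds: (1) The total number of odd parts of $\mu$ (counted with multiplicity) is odd, and if $k$ is the smallest odd part of $\mu$, and $l$ is the largest even part of $\mu$ (where $l=0$ if $\mu$ has no even parts), then $k-l\ge 3$. (2) The partition $\mu$ has exactly one odd part (counted with multiplicity), say $k\ge 3$, and if $l$ is the largest even part of $\mu$, then $k-l=1$ and $l$ has multiplicity one in $\mu$. Then $g$ is not strongly real in $\mathrm{U}(n,\mathbb{F}_q)$.
   Context: For a prime power $q$ write $\bar a=a^q$ for $a\in\mathbb{F}_{q^2}$, and apply the bar entrywise to matrices. The finite unitary group is $\mathrm{U}(n,\mathbb{F}_q)=\{g\in \mathrm{GL}(n,\mathbb{F}_{q^2}) : {}^{\top}\bar g\, g=I_n\}$; up to isomorphism it is the isometry group of any non-degenerate Hermitian form on an $n$-dimensional $\mathbb{F}_{q^2}$-vector space. An element $g$ of a group $G$ is strongly real in $G$ if there is $s\in G$ with $s^2=1$ and $sgs=g^{-1}$. The parts of $\mu$ are the sizes of the Jordan blocks of $g$ with eigenvalue $1$. *)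

theory Defs
  imports
    "Jordan_Normal_Form.Jordan_Normal_Form"
    "HOL-Number_Theory.Residues"
    "HOL-Library.Multiset"
    "HOL-Library.Cardinality"
begin

subsection \<open>Strongly real elements\<close>

definition strongly_real :: "('g, 'b) monoid_scheme \<Rightarrow> 'g \<Rightarrow> bool" where
  "strongly_real G g \<longleftrightarrow>
     (\<exists>s\<in>carrier G. s \<otimes>\<^bsub>G\<^esub> s = \<one>\<^bsub>G\<^esub> \<and> s \<otimes>\<^bsub>G\<^esub> g \<otimes>\<^bsub>G\<^esub> s = inv\<^bsub>G\<^esub> g)"


subsection \<open>The finite unitary group\<close>

abbreviation general_linear_group :: "nat \<Rightarrow> 'a :: field mat monoid" where
  "general_linear_group n \<equiv> units_of (ring_mat TYPE('a) n ())"

definition bar_mat :: "nat \<Rightarrow> 'a :: field mat \<Rightarrow> 'a mat" where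
  "bar_mat q A = map_mat (\<lambda>a. a ^ q) A"

text \<open>This is \<open>U(n, F\<^sub>q)\<close> when the field \<^typ>\<open>'a\<close> of matrix entries has \<open>q\<^sup>2\<close> elements.\<close>

definition unitary_group :: "nat \<Rightarrow> nat \<Rightarrow> 'a :: field mat monoid" where
  "unitary_group n q = (general_linear_group n)
     \<lparr>carrier := {g \<in> carrier (general_linear_group n).
                    transpose_mat (bar_mat q g) * g = 1\<^sub>m n}\<rparr>"


subsection \<open>Elementary divisors\<close>

text \<open>
  The multiset \<open>\<mu>\<close> consists of the exponents of the elementary divisors of \<open>A\<close> that are powers of
  \<open>t - a\<close>, i.e. of the sizes of the Jordan blocks of \<open>A\<close> with eigenvalue \<open>a\<close>. Since the
  characteristic polynomial of \<open>A\<close> need not split over the ground field, only the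
  \<open>a\<close>-primary part is brought into Jordan form; the remaining summand \<open>B\<close> (possibly of size 0)
  does not have \<open>a\<close> as an eigenvalue. For every square \<open>A\<close> over a field there is exactly one
  such \<open>\<mu>\<close>; it is empty if \<open>a\<close> is not an eigenvalue of \<open>A\<close>.
\<close>

definition elementary_divisor_partition :: "'a :: field mat \<Rightarrow> 'a \<Rightarrow> nat multiset \<Rightarrow> bool" where
  "elementary_divisor_partition A a \<mu> \<longleftrightarrow>
     0 \<notin># \<mu> \<and>
     (\<exists>ks m B. mset ks = \<mu> \<and> B \<in> carrier_mat m m \<and> \<not> eigenvalue B a \<and>
        similar_mat A (diag_block_mat [jordan_matrix (map (\<lambda>k. (k, a)) ks), B]))"


subsection \<open>Odd and even parts of a partition\<close>

abbreviation odd_parts :: "nat multiset \<Rightarrow> nat multiset" where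
  "odd_parts \<mu> \<equiv> filter_mset odd \<mu>"

abbreviation even_parts :: "nat multiset \<Rightarrow> nat multiset" where
  "even_parts \<mu> \<equiv> filter_mset even \<mu>"

text \<open>Only meaningful if \<open>\<mu>\<close> has an odd part.\<close>

definition smallest_odd_part :: "nat multiset \<Rightarrow> nat" where
  "smallest_odd_part \<mu> = Min (set_mset (odd_parts \<mu>))"

definition largest_even_part :: "nat multiset \<Rightarrow> nat" where
  "largest_even_part \<mu> =
     (if even_parts \<mu> = {#} then 0 else Max (set_mset (even_parts \<mu>)))"


subsection \<open>The unitary group is a group\<close>

lemma power_card_prime_power_add:
  fixes a b :: "'a :: {field, finite}"
  assumes "prime p" and "q = p ^ m" and "CARD('a) = q ^ 2"
  shows "(a + b) ^ q = a ^ q + b ^ q"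
proof -
  have "CHAR('a) > 0"
    by (rule finite_imp_CHAR_pos) auto
  then have pr: "prime CHAR('a)"
    by (rule prime_CHAR_semidom)
  have "CHAR('a) dvd p ^ (m * 2)"
    using CHAR_dvd_CARD[where 'a = 'a] assms by (simp add: power_mult)
  with pr assms(1) have "CHAR('a) = p"
    by (metis prime_dvd_power primes_dvd_imp_eq)
  then show ?thesis
    using freshmans_dream'[where 'a = 'a, of q m a b] pr assms(2) by simp
qed

lemma bar_mat_mult:
  fixes A B :: "'a :: {field, finite} mat"
  assumes q: "prime p" "q = p ^ m" "CARD('a) = q ^ 2"
    and A: "A \<in> carrier_mat n n" and B: "B \<in> carrier_mat n n"
  shows "bar_mat q (A * B) = bar_mat q A * bar_mat q B"
proof -
  have q0: "q > 0" using q by (simp add: prime_gt_0_nat)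
  have *: "(\<Sum>i\<in>I. f i) ^ q = (\<Sum>i\<in>I. f i ^ q)" if "finite I" for I :: "nat set" and f :: "nat \<Rightarrow> 'a"
    using that q0
    by (induction I rule: finite_induct) (simp_all add: power_card_prime_power_add[OF q])
  show ?thesis
    using A B by (intro eq_matI) (auto simp: bar_mat_def scalar_prod_def * power_mult_distrib)
qed

lemma bar_mat_one: "q > 0 \<Longrightarrow> bar_mat q (1\<^sub>m n) = (1\<^sub>m n :: 'a :: field mat)"
  by (intro eq_matI) (auto simp: bar_mat_def)

lemma unitary_group_subgroup:
  assumes q: "prime p" "q = p ^ m" "card (UNIV :: 'a :: {field, finite} set) = q ^ 2"
  shows "subgroup (carrier (unitary_group n q :: 'a mat monoid)) (general_linear_group n)"
proof -
  interpret R: ring "ring_mat TYPE('a) n ()" by (rule ring_mat)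
  interpret GL: group "general_linear_group n :: 'a mat monoid" by (rule R.units_group)
  let ?bt = "\<lambda>A :: 'a mat. transpose_mat (bar_mat q A)"
  have q0: "q > 0" using q by (simp add: prime_gt_0_nat)
  have cm: "g \<in> carrier_mat n n" if "g \<in> carrier (general_linear_group n)" for g :: "'a mat"
    using that by (auto simp: units_of_carrier Units_def ring_mat_simps)
  have bc: "?bt g \<in> carrier_mat n n" if "g \<in> carrier_mat n n" for g
    using that by (auto simp: bar_mat_def)
  have bm: "?bt (g * h) = ?bt h * ?bt g"
    if "g \<in> carrier_mat n n" "h \<in> carrier_mat n n" for g h
    using bar_mat_mult[OF q that] that by (simp add: bar_mat_def transpose_mult[of _ n n _ n])
  have gl: "x \<otimes>\<^bsub>general_linear_group n\<^esub> y = x * y" "\<one>\<^bsub>general_linear_group n\<^esub> = (1\<^sub>m n :: 'a mat)"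
    for x y :: "'a mat"
    by (simp_all add: units_of_mult units_of_one ring_mat_simps)
  show ?thesis
  proof (rule GL.subgroupI)
    show "carrier (unitary_group n q :: 'a mat monoid) \<subseteq> carrier (general_linear_group n)"
      by (auto simp: unitary_group_def)
    have "1\<^sub>m n \<in> carrier (unitary_group n q :: 'a mat monoid)"
      using GL.one_closed q0 by (simp add: unitary_group_def gl bar_mat_one)
    then show "carrier (unitary_group n q :: 'a mat monoid) \<noteq> {}" by auto
  next
    fix g :: "'a mat" assume g: "g \<in> carrier (unitary_group n q)"
    define h where "h = inv\<^bsub>general_linear_group n\<^esub> g"
    from g have gG: "g \<in> carrier (general_linear_group n)" and gu: "?bt g * g = 1\<^sub>m n"
      by (auto simp: unitary_group_def)
    have hG: "h \<in> carrier (general_linear_group n)" unfolding h_def using gG by simp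
    have gh: "g * h = 1\<^sub>m n" using GL.r_inv[OF gG] by (simp add: gl h_def)
    note c = cm[OF gG] cm[OF hG] bc[OF cm[OF gG]] bc[OF cm[OF hG]]
    have "?bt h * h = ?bt h * ((?bt g * g) * h)" using c gu by simp
    also have "\<dots> = (?bt h * ?bt g) * (g * h)" using c by (simp add: assoc_mult_mat[of _ n n _ n _ n])
    also have "\<dots> = ?bt (g * h)" using c bm[OF c(1,2)] gh by simp
    also have "\<dots> = 1\<^sub>m n" using gh q0 by (simp add: bar_mat_one)
    finally show "inv\<^bsub>general_linear_group n\<^esub> g \<in> carrier (unitary_group n q)"
      using hG by (simp add: unitary_group_def h_def)
  next
    fix g h :: "'a mat"
    assume g: "g \<in> carrier (unitary_group n q)" and h: "h \<in> carrier (unitary_group n q)"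
    from g h have G: "g \<in> carrier (general_linear_group n)" "h \<in> carrier (general_linear_group n)"
      and u: "?bt g * g = 1\<^sub>m n" "?bt h * h = 1\<^sub>m n"
      by (auto simp: unitary_group_def)
    note c = cm[OF G(1)] cm[OF G(2)] bc[OF cm[OF G(1)]] bc[OF cm[OF G(2)]]
    have "?bt (g * h) * (g * h) = ?bt h * ((?bt g * g) * h)"
      using c by (simp add: bm[OF c(1,2)] assoc_mult_mat[of _ n n _ n _ n])
    also have "\<dots> = 1\<^sub>m n" using u c by simp
    finally show "g \<otimes>\<^bsub>general_linear_group n\<^esub> h \<in> carrier (unitary_group n q)"
      using GL.m_closed[OF G] by (simp add: unitary_group_def gl)
  qed
qed

lemma unitary_group_group:
  assumes "prime p" "q = p ^ m" "card (UNIV :: 'a :: {field, finite} set) = q ^ 2"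
  shows "group (unitary_group n q :: 'a mat monoid)"
proof -
  interpret R: ring "ring_mat TYPE('a) n ()" by (rule ring_mat)
  interpret GL: group "general_linear_group n :: 'a mat monoid" by (rule R.units_group)
  show ?thesis
    using GL.subgroup_imp_group[OF unitary_group_subgroup[OF assms]]
    by (simp add: unitary_group_def)
qed

end

theory Submission
  imports Defs
    "Jordan_Normal_Form.Jordan_Normal_Form_Uniqueness"
    "HOL-Library.Function_Algebras"
    "HOL-Library.Product_Plus"
begin

text \<open>
  Let \<open>s\<close> be a unitary involution that inverts \<open>g\<close>, and put \<open>N = g - 1 = g + 1\<close>, the two expressions
  being equal in characteristic 2. The obstruction to the existence of \<open>s\<close> is a parity:
  if \<open>j\<close> is odd and is not the size of a Jordan block of \<open>g\<close> with eigenvalue 1, then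
  \<open>N\<^sup>j\<^sup>+\<^sup>1 V\<close> has even dimension.

  To see this, let \<open>E = N\<^sup>j V\<close>. From \<open>s g s = g\<^sup>-\<^sup>1\<close> follows \<open>N s = g s N\<close>, so both involutions \<open>s\<close> and
  \<open>g s\<close> act on \<open>E\<close>. Put \<open>X = (1 + s) E\<close> and \<open>Y = (1 + g s) E\<close>. Three facts determine the parity:

  \<^item> \<open>dim X = dim Y\<close>. The adjoint of \<open>(1 + s) N\<^sup>j\<close> with respect to the form is, up to a power of \<open>g\<close>,
    \<open>N\<^sup>j (1 + s)\<close>, whose range is \<open>(1 + g\<^sup>j s) E\<close>; as \<open>j\<close> is odd, \<open>g\<^sup>j s\<close> is conjugate to \<open>g s\<close> under a
    power of \<open>g\<close>.

  \<^item> \<open>X \<inter> Y = (1 + s) K\<close> for \<open>K = E \<inter> ker N\<close>. This is where the absence of blocks of size \<open>j\<close> enters,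
    in the form that \<open>ker N \<inter> N\<^sup>j\<^sup>-\<^sup>1 V\<close> lies in \<open>E\<close>.

  \<^item> \<open>dim (X + Y) = dim (N E) + dim ((1 + s) K)\<close>. Indeed \<open>X + Y = X + N E\<close>, and the orthogonal
    complement of this space is mapped by \<open>N\<^sup>j\<close> onto the fixed points of \<open>s\<close> in \<open>K\<close>.

  Hence \<open>2 dim X = dim X + dim Y = dim (X + Y) + dim (X \<inter> Y) = dim (N\<^sup>j\<^sup>+\<^sup>1 V) + 2 dim ((1 + s) K)\<close>.
  All dimensions are read off from cardinalities: the spaces are finite, a subspace of dimension \<open>d\<close>
  has \<open>|F|\<^sup>d\<close> elements, and counting the fibres of additive maps replaces the rank-nullity theorem,
  Grassmann's formula and the dimension formula for orthogonal complements.

  In terms of \<open>\<mu>\<close> the parity statement (\<open>strongly_real_imp_even_corank\<close>) says that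
  \<open>n - (\<Sum>l. min (j + 1) l)\<close>, with \<open>l\<close> ranging over the parts of \<open>\<mu>\<close>, is even. Let \<open>k\<close> be the smallest
  odd part. Comparing \<open>j = k - 2\<close>, which is not a part, with an odd \<open>j\<close> beyond all parts shows that the
  sum of \<open>l - (k - 1)\<close> over the parts \<open>l \<ge> k\<close> is even. In both cases of the theorem the parts
  \<open>l \<ge> k\<close> are exactly the odd ones, each of which contributes an odd number, and there are oddly
  many of them: a contradiction.
\<close>

section \<open>Counting in finite sesquilinear spaces\<close>

lemma card_image_mult_card_kernel:
  fixes f :: "'b :: ab_group_add \<Rightarrow> 'c :: ab_group_add"
  assumes fin: "finite A" and 0: "0 \<in> A"
    and add: "\<And>x y. x \<in> A \<Longrightarrow> y \<in> A \<Longrightarrow> x + y \<in> A"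
    and uminus: "\<And>x. x \<in> A \<Longrightarrow> - x \<in> A"
    and hom: "\<And>x y. x \<in> A \<Longrightarrow> y \<in> A \<Longrightarrow> f (x + y) = f x + f y"
  shows "card (f ` A) * card {x \<in> A. f x = 0} = card A"
proof -
  have fibre: "card {x \<in> A. f x = y} = card {x \<in> A. f x = 0}" if "y \<in> f ` A" for y
  proof -
    from that obtain a where a: "a \<in> A" "y = f a" by auto
    have f0: "f 0 = 0" using hom[OF 0 0] by simp
    have fm: "f (- a) = - f a"
      using hom[OF a(1) uminus[OF a(1)]] f0 by (simp add: eq_neg_iff_add_eq_0 add.commute)
    have "bij_betw (\<lambda>x. x + a) {x \<in> A. f x = 0} {x \<in> A. f x = y}"
      by (rule bij_betw_byWitness[where f' = "\<lambda>x. x + - a"])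
         (use a add uminus hom fm in \<open>auto simp del: add_uminus_conv_diff simp: add.assoc\<close>)
    then show ?thesis by (simp add: bij_betw_same_card)
  qed
  have "card A = (\<Sum>y\<in>f ` A. card {x \<in> A. f x = y})"
    using fin sum.image_gen[of A "\<lambda>_. 1::nat" f] by simp
  also have "\<dots> = card (f ` A) * card {x \<in> A. f x = 0}"
    using fibre by simp
  finally show ?thesis by simp
qed

lemma card_field_gt_1: "CARD('a :: {field, finite}) > 1"
proof -
  have "card {0, 1 :: 'a} \<le> CARD('a)" by (intro card_mono) auto
  then show ?thesis by simp
qed

text \<open>
  The space is a finite subset \<open>V\<close> of a vector space, so that it can be a space of coordinate vectors
  whose dimension is a variable. The form is linear in the second argument and semilinear in the
  first; the twist \<open>cnj\<close> of the scalars is onto so that nonzero functionals \<open>\<lambda>x. H x u\<close> take all values.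
\<close>

locale finite_sesquilinear_space = vector_space smult
  for smult :: "'a :: {field, finite} \<Rightarrow> 'v :: ab_group_add \<Rightarrow> 'v" +
  fixes V :: "'v set" and H :: "'v \<Rightarrow> 'v \<Rightarrow> 'a" and cnj :: "'a \<Rightarrow> 'a"
  assumes subspace_V: "subspace V" and finite_V: "finite V"
    and H_add_left: "\<lbrakk>x \<in> V; y \<in> V; z \<in> V\<rbrakk> \<Longrightarrow> H (x + y) z = H x z + H y z"
    and H_add_right: "\<lbrakk>x \<in> V; y \<in> V; z \<in> V\<rbrakk> \<Longrightarrow> H x (y + z) = H x y + H x z"
    and H_smult_left: "\<lbrakk>x \<in> V; y \<in> V\<rbrakk> \<Longrightarrow> H (smult c x) y = cnj c * H x y"
    and H_smult_right: "\<lbrakk>x \<in> V; y \<in> V\<rbrakk> \<Longrightarrow> H x (smult c y) = c * H x y"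
    and surj_cnj: "surj cnj"
    and nondegenerate_left: "\<lbrakk>x \<in> V; \<And>y. y \<in> V \<Longrightarrow> H x y = 0\<rbrakk> \<Longrightarrow> x = 0"
    and nondegenerate_right: "\<lbrakk>y \<in> V; \<And>x. x \<in> V \<Longrightarrow> H x y = 0\<rbrakk> \<Longrightarrow> y = 0"
begin

definition perp :: "'v set \<Rightarrow> 'v set" where
  "perp U = {v \<in> V. \<forall>u\<in>U. H v u = 0}"

lemma card_linear_image_mult_card_kernel:
  fixes f :: "'v \<Rightarrow> 'w :: ab_group_add"
  assumes U: "subspace U" "U \<subseteq> V"
    and hom: "\<And>x y. x \<in> U \<Longrightarrow> y \<in> U \<Longrightarrow> f (x + y) = f x + f y"
  shows "card (f ` U) * card {x \<in> U. f x = 0} = card U"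
  using U finite_subset[OF _ finite_V]
  by (intro card_image_mult_card_kernel hom) (auto intro: subspace_0 subspace_add subspace_neg)

lemma card_functional_kernel_right:
  assumes U: "subspace U" "U \<subseteq> V" and v: "v \<in> V" and u: "u \<in> U" "H v u \<noteq> 0"
  shows "CARD('a) * card {x \<in> U. H v x = 0} = card U"
proof -
  have "H v ` U = UNIV"
  proof (intro equalityI subsetI)
    fix c :: 'a
    have "H v (smult (c / H v u) u) = c" using U v u by (subst H_smult_right) auto
    then show "c \<in> H v ` U" using U u by (metis imageI subspace_scale)
  qed auto
  then show ?thesis
    using card_linear_image_mult_card_kernel[OF U, of "H v"] U v by (auto simp: H_add_right subset_iff)
qed

lemma card_functional_kernel_left:
  assumes u: "u \<in> V" "u \<noteq> 0"
  shows "CARD('a) * card {x \<in> V. H x u = 0} = card V"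
proof -
  obtain v where v: "v \<in> V" "H v u \<noteq> 0" using nondegenerate_right u by blast
  have "(\<lambda>x. H x u) ` V = UNIV"
  proof (intro equalityI subsetI)
    fix c :: 'a
    obtain d where d: "cnj d = c / H v u" using surj_cnj by (metis surjD)
    have "H (smult d v) u = c" using v u by (simp add: H_smult_left d)
    then show "c \<in> (\<lambda>x. H x u) ` V" using subspace_V v by (metis imageI subspace_scale)
  qed auto
  then show ?thesis
    using card_linear_image_mult_card_kernel[OF subspace_V, of "\<lambda>x. H x u"] u by (auto simp: H_add_left)
qed

text \<open>
  The pairs \<open>(v, u)\<close> in \<open>V \<times> U\<close> with \<open>H v u = 0\<close> are counted in two ways. A functional on a subspace
  vanishes on everything or on a fraction \<open>1 / |F|\<close> of it: the first happens for \<open>v\<close> in the complement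
  of \<open>U\<close>, respectively for \<open>u = 0\<close>.
\<close>

lemma card_mult_card_perp:
  assumes U: "subspace U" "U \<subseteq> V"
  shows "card U * card (perp U) = card V"
proof -
  let ?Q = "CARD('a)"
  have finU: "finite U" using U finite_V finite_subset by blast
  have Q: "?Q > 1" by (rule card_field_gt_1)
  have 0: "0 \<in> U" "0 \<in> V" using U subspace_V by (auto simp: subspace_0)
  have H0: "H v 0 = 0" if "v \<in> V" for v using H_smult_right[of v 0 0] that 0 by simp
  have PV: "perp U \<subseteq> V" by (auto simp: perp_def)
  have "(\<Sum>v\<in>V. card {u \<in> U. H v u = 0}) = card (SIGMA v:V. {u \<in> U. H v u = 0})"
    using finite_V finU by simp
  also have "\<dots> = card (SIGMA u:U. {v \<in> V. H v u = 0})"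
    by (intro bij_betw_same_card[of prod.swap] bij_betw_byWitness[where f' = prod.swap]) auto
  also have "\<dots> = (\<Sum>u\<in>U. card {v \<in> V. H v u = 0})"
    using finite_V finU by simp
  finally have "(\<Sum>v\<in>V. ?Q * card {u \<in> U. H v u = 0}) = (\<Sum>u\<in>U. ?Q * card {v \<in> V. H v u = 0})"
    by (simp add: sum_distrib_left[symmetric])
  also have "(\<Sum>v\<in>V. ?Q * card {u \<in> U. H v u = 0})
      = (\<Sum>v\<in>V. card U + (if v \<in> perp U then (?Q - 1) * card U else 0))"
  proof (rule sum.cong)
    fix v assume v: "v \<in> V"
    show "?Q * card {u \<in> U. H v u = 0} = card U + (if v \<in> perp U then (?Q - 1) * card U else 0)"
    proof (cases "v \<in> perp U")
      case True
      then have "{u \<in> U. H v u = 0} = U" by (auto simp: perp_def)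
      with True Q show ?thesis by (cases ?Q) auto
    next
      case False
      then obtain u where "u \<in> U" "H v u \<noteq> 0" using v by (auto simp: perp_def)
      with False card_functional_kernel_right[OF U v] show ?thesis by simp
    qed
  qed simp
  also have "\<dots> = card V * card U + card (perp U) * ((?Q - 1) * card U)"
    using PV finite_V by (simp add: sum.distrib sum.If_cases Int_absorb1)
  also have "(\<Sum>u\<in>U. ?Q * card {v \<in> V. H v u = 0})
      = (\<Sum>u\<in>U. card V + (if u = 0 then (?Q - 1) * card V else 0))"
  proof (rule sum.cong)
    fix u assume u: "u \<in> U"
    show "?Q * card {v \<in> V. H v u = 0} = card V + (if u = 0 then (?Q - 1) * card V else 0)"
    proof (cases "u = 0")
      case True
      then have "{v \<in> V. H v u = 0} = V" using H0 by auto
      with True Q show ?thesis by (cases ?Q) auto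
    next
      case False
      with card_functional_kernel_left[of u] u U show ?thesis by auto
    qed
  qed simp
  also have "\<dots> = card U * card V + (?Q - 1) * card V"
    using 0 finU by (simp add: sum.distrib)
  finally have "(?Q - 1) * (card U * card (perp U)) = (?Q - 1) * card V" by (simp add: ac_simps)
  then show ?thesis using Q by simp
qed

lemma perp_sum:
  assumes A: "subspace A" "A \<subseteq> V" and B: "subspace B" "B \<subseteq> V"
  shows "perp {a + b | a b. a \<in> A \<and> b \<in> B} = perp A \<inter> perp B"
proof (intro equalityI subsetI)
  fix v assume v: "v \<in> perp {a + b | a b. a \<in> A \<and> b \<in> B}"
  have "H v a = 0" if "a \<in> A" for a
  proof -
    have "a \<in> {a + b | a b. a \<in> A \<and> b \<in> B}"
      by (rule CollectI, rule exI[of _ a], rule exI[of _ 0]) (simp add: that subspace_0 B)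
    then show ?thesis using v by (simp only: perp_def mem_Collect_eq)
  qed
  moreover have "H v b = 0" if "b \<in> B" for b
  proof -
    have "b \<in> {a + b | a b. a \<in> A \<and> b \<in> B}"
      by (rule CollectI, rule exI[of _ 0], rule exI[of _ b]) (simp add: that subspace_0 A)
    then show ?thesis using v by (simp only: perp_def mem_Collect_eq)
  qed
  ultimately show "v \<in> perp A \<inter> perp B" using v by (simp add: perp_def)
next
  fix v assume "v \<in> perp A \<inter> perp B"
  then show "v \<in> perp {a + b | a b. a \<in> A \<and> b \<in> B}"
    using A(2) B(2) by (auto simp: perp_def H_add_right subset_iff)
qed

text \<open>
  By nondegeneracy a nonzero subspace carries a nonzero functional, and the kernel of the functional
  is smaller by the factor \<open>|F|\<close>.
\<close>

lemma card_subspace_power: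
  assumes "subspace U" "U \<subseteq> V"
  shows "\<exists>d. card U = CARD('a) ^ d"
  using assms
proof (induction "card U" arbitrary: U rule: less_induct)
  case less
  show ?case
  proof (cases "U = {0}")
    case True
    then show ?thesis by (intro exI[of _ 0]) simp
  next
    case False
    then obtain u where u: "u \<in> U" "u \<noteq> 0" using less.prems subspace_0 by blast
    obtain v where v: "v \<in> V" "H v u \<noteq> 0" using nondegenerate_right u less.prems by blast
    let ?K = "{x \<in> U. H v x = 0}"
    have sub: "subspace ?K"
    proof (rule subspaceI)
      show "0 \<in> ?K" using H_smult_right[of v 0 0] v subspace_0[OF subspace_V] less.prems by (simp add: subspace_0)
    qed (use v less.prems in \<open>auto simp: subspace_add subspace_scale H_add_right H_smult_right subset_iff\<close>)
    have "?K \<subset> U" using u v by auto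
    then have lt: "card ?K < card U"
      using less.prems finite_V by (meson finite_subset psubset_card_mono)
    obtain d where "card ?K = CARD('a) ^ d"
      using less.hyps[OF lt sub] less.prems by auto
    with card_functional_kernel_right[OF less.prems v(1) u(1) v(2)] show ?thesis
      by (intro exI[of _ "Suc d"]) simp
  qed
qed

text \<open>
  Grassmann's formula: addition \<open>A \<times> B \<rightarrow> A + B\<close> has as its kernel a copy of \<open>A \<inter> B\<close>.
\<close>

lemma card_sum_mult_card_Int:
  assumes A: "subspace A" "A \<subseteq> V" and B: "subspace B" "B \<subseteq> V"
  shows "card {a + b | a b. a \<in> A \<and> b \<in> B} * card (A \<inter> B) = card A * card B"
proof -
  let ?f = "\<lambda>(a, b). a + b"
  have fin: "finite (A \<times> B)" using A B finite_V by (meson finite_SigmaI finite_subset)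
  have "card (?f ` (A \<times> B)) * card {p \<in> A \<times> B. ?f p = 0} = card (A \<times> B)"
    using A(1) B(1) fin
    by (intro card_image_mult_card_kernel)
       (auto simp: zero_prod_def subspace_0 subspace_add subspace_neg)
  moreover have "bij_betw (\<lambda>a. (a, - a)) (A \<inter> B) {p \<in> A \<times> B. ?f p = 0}"
    using A(1) B(1)
    by (intro bij_betw_byWitness[where f' = fst])
       (auto simp: subspace_neg add_eq_0_iff dest: subspace_neg)
  then have "card {p \<in> A \<times> B. ?f p = 0} = card (A \<inter> B)" by (simp add: bij_betw_same_card)
  moreover have "?f ` (A \<times> B) = {a + b | a b. a \<in> A \<and> b \<in> B}" by auto
  ultimately show ?thesis by (simp add: card_cartesian_product)
qed

end

section \<open>Isometries inverted by an involution\<close>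

text \<open>
  The equation \<open>g s g = s\<close> expresses that the involution \<open>s\<close> inverts \<open>g\<close> without mentioning
  \<open>g\<^sup>-\<^sup>1\<close>. The equations for \<open>g\<close> and \<open>s\<close> are required on \<open>V\<close> only; linearity on the whole type is
  harmless, as matrices act on all coordinate functions.
\<close>

locale reversed_isometry = finite_sesquilinear_space smult V H cnj
  for smult :: "'a :: {field, finite} \<Rightarrow> 'v :: ab_group_add \<Rightarrow> 'v" and V H cnj +
  fixes g s :: "'v \<Rightarrow> 'v"
  assumes two_eq_0: "(1 :: 'a) + 1 = 0"
    and linear_g: "Vector_Spaces.linear smult smult g"
    and linear_s: "Vector_Spaces.linear smult smult s"
    and g_in_V: "x \<in> V \<Longrightarrow> g x \<in> V" and s_in_V: "x \<in> V \<Longrightarrow> s x \<in> V"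
    and H_g: "\<lbrakk>x \<in> V; y \<in> V\<rbrakk> \<Longrightarrow> H (g x) (g y) = H x y"
    and H_s: "\<lbrakk>x \<in> V; y \<in> V\<rbrakk> \<Longrightarrow> H (s x) (s y) = H x y"
    and s_s: "x \<in> V \<Longrightarrow> s (s x) = x"
    and g_s_g: "x \<in> V \<Longrightarrow> g (s (g x)) = s x"
begin

definition N :: "'v \<Rightarrow> 'v" where "N x = g x + x"

abbreviation range_N :: "nat \<Rightarrow> 'v set" where "range_N j \<equiv> (N ^^ j) ` V"

sublocale g: Vector_Spaces.linear smult smult g by (rule linear_g)
sublocale s: Vector_Spaces.linear smult smult s by (rule linear_s)

lemma add_self [simp]: "(x :: 'v) + x = 0"
proof -
  have "x + x = smult (1 + 1) x" by (simp only: scale_left_distrib scale_one)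
  then show ?thesis by (simp add: two_eq_0 del: one_add_one)
qed

lemma add_self_left [simp]: "(x :: 'v) + (x + y) = y"
  by (simp add: add.assoc[symmetric])

lemma add_eq_0_iff_eq: "(x :: 'v) + y = 0 \<longleftrightarrow> x = y"
  by (metis add_self add_right_imp_eq)

lemma linearI:
  assumes "\<And>x y. f (x + y) = f x + f y" "\<And>c x. f (smult c x) = smult c (f x)"
  shows "Vector_Spaces.linear smult smult f"
  unfolding Vector_Spaces.linear_iff using assms vector_space_axioms by blast

lemma linear_funpow:
  assumes "Vector_Spaces.linear smult smult f"
  shows "Vector_Spaces.linear smult smult (f ^^ j)"
proof (induction j)
  case 0
  show ?case by (intro linearI) simp_all
next
  case (Suc j)
  then interpret fj: Vector_Spaces.linear smult smult "f ^^ j" .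
  interpret f: Vector_Spaces.linear smult smult f by fact
  show ?case by (intro linearI) (simp_all add: fj.add fj.scale f.add f.scale)
qed

lemma linear_add:
  assumes "Vector_Spaces.linear smult smult f" "Vector_Spaces.linear smult smult f'"
  shows "Vector_Spaces.linear smult smult (\<lambda>x. f x + f' x)"
proof -
  interpret f: Vector_Spaces.linear smult smult f by fact
  interpret f': Vector_Spaces.linear smult smult f' by fact
  show ?thesis
    by (intro linearI) (simp_all add: f.add f.scale f'.add f'.scale scale_right_distrib ac_simps)
qed

lemma linear_id: "Vector_Spaces.linear smult smult (\<lambda>x. x)" by (intro linearI) simp_all

lemma subspace_image_linear:
  assumes "Vector_Spaces.linear smult smult f" "subspace U"
  shows "subspace (f ` U)"
proof -
  interpret f: Vector_Spaces.linear smult smult f by fact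
  show ?thesis using assms(2) by (rule f.subspace_image)
qed

lemma linear_N: "Vector_Spaces.linear smult smult N"
  unfolding N_def[abs_def] by (intro linear_add linear_g linear_id)

sublocale N: Vector_Spaces.linear smult smult N by (rule linear_N)
sublocale Npow: Vector_Spaces.linear smult smult "N ^^ j" for j by (rule linear_funpow[OF linear_N])
sublocale gpow: Vector_Spaces.linear smult smult "g ^^ j" for j by (rule linear_funpow[OF linear_g])

lemma add_in_V: "\<lbrakk>x \<in> V; y \<in> V\<rbrakk> \<Longrightarrow> x + y \<in> V"
  using subspace_V by (rule subspace_add)

lemma N_in_V: "x \<in> V \<Longrightarrow> N x \<in> V"
  unfolding N_def by (intro add_in_V g_in_V)

lemma Npow_in_V: "x \<in> V \<Longrightarrow> (N ^^ j) x \<in> V"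
  by (induction j) (auto intro: N_in_V)

lemma gpow_in_V: "x \<in> V \<Longrightarrow> (g ^^ j) x \<in> V"
  by (induction j) (auto intro: g_in_V)

lemmas in_V = add_in_V g_in_V s_in_V N_in_V Npow_in_V gpow_in_V

lemma s_g_s_g: "x \<in> V \<Longrightarrow> s (g (s (g x))) = x"
  by (simp add: g_s_g s_s)

lemma gpow_s_gpow: "x \<in> V \<Longrightarrow> (g ^^ j) (s ((g ^^ j) x)) = s x"
proof (induction j arbitrary: x)
  case (Suc j)
  have "(g ^^ Suc j) (s ((g ^^ Suc j) x)) = g ((g ^^ j) (s ((g ^^ j) (g x))))"
    by (simp add: funpow_swap1)
  with Suc show ?case by (simp add: in_V g_s_g)
qed simp

lemma gpow_surj:
  assumes "v \<in> V"
  obtains w where "w \<in> V" "v = (g ^^ j) w"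
proof
  show "s ((g ^^ j) (s v)) \<in> V" using assms by (intro in_V)
  show "v = (g ^^ j) (s ((g ^^ j) (s v)))" using assms by (simp add: gpow_s_gpow s_s in_V)
qed

lemma gpow_eq_0: "x \<in> V \<Longrightarrow> (g ^^ j) x = 0 \<longleftrightarrow> x = 0"
  by (metis gpow_s_gpow gpow.zero s.zero s_s)

lemma inj_gpow: "inj_on (g ^^ j) V"
  by (intro inj_onI) (metis gpow_s_gpow s_s)

lemma N_g: "N (g x) = g (N x)" unfolding N_def by (simp add: g.add)

lemma N_gpow: "N ((g ^^ j) x) = (g ^^ j) (N x)" by (induction j) (simp_all add: N_g)

lemma Npow_gpow: "(N ^^ i) ((g ^^ j) x) = (g ^^ j) ((N ^^ i) x)" by (induction i) (simp_all add: N_gpow)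

lemma N_s: "x \<in> V \<Longrightarrow> N (s x) = g (s (N x))"
  unfolding N_def by (simp add: s.add g.add g_s_g add.commute)

lemma s_N: "x \<in> V \<Longrightarrow> s (N x) = N (s (g x))"
  unfolding N_def by (simp add: s.add g_s_g)

lemma Npow_s: "x \<in> V \<Longrightarrow> (N ^^ j) (s x) = (g ^^ j) (s ((N ^^ j) x))"
  by (induction j) (simp_all add: N_gpow N_s in_V funpow_swap1)

text \<open>
  For \<open>j = 1\<close> both sides are \<open>H x y + H (g x) y\<close>: up to powers of \<open>g\<close>, \<open>N\<close> is its own adjoint.
\<close>

lemma H_gpow_Npow:
  assumes "x \<in> V" "y \<in> V"
  shows "H ((g ^^ j) x) ((N ^^ j) y) = H ((N ^^ j) x) y"
  using assms
proof (induction j arbitrary: x y)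
  case (Suc j)
  have 1: "H (g x) (N y) = H (N x) y" if "x \<in> V" "y \<in> V" for x y
    using that by (simp add: N_def H_add_left H_add_right H_g in_V add.commute)
  have "H ((g ^^ Suc j) x) ((N ^^ Suc j) y) = H (g ((g ^^ j) x)) (N ((N ^^ j) y))" by simp
  also have "\<dots> = H ((g ^^ j) (N x)) ((N ^^ j) y)" using Suc.prems by (simp add: 1 in_V N_gpow)
  also have "\<dots> = H ((N ^^ Suc j) x) y" using Suc by (simp add: in_V funpow_swap1)
  finally show ?case .
qed simp

lemma H_s_left: "\<lbrakk>x \<in> V; y \<in> V\<rbrakk> \<Longrightarrow> H (s x) y = H x (s y)"
  using H_s[of x "s y"] by (simp add: in_V s_s)

lemma H_zero_left: "x \<in> V \<Longrightarrow> H 0 x = 0"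
  using H_add_left[of 0 0 x] subspace_0[OF subspace_V] add_left_cancel[of "H 0 x" "H 0 x" 0] by simp

lemma H_range_N_eq_0_iff:
  assumes v: "v \<in> V"
  shows "(\<forall>x\<in>V. H v ((N ^^ j) x) = 0) \<longleftrightarrow> (N ^^ j) v = 0"
proof -
  obtain w where w: "w \<in> V" "v = (g ^^ j) w" using gpow_surj[OF v] .
  have "(\<forall>x\<in>V. H v ((N ^^ j) x) = 0) \<longleftrightarrow> (\<forall>x\<in>V. H ((N ^^ j) w) x = 0)"
    using w by (simp add: H_gpow_Npow)
  also have "\<dots> \<longleftrightarrow> (N ^^ j) w = 0"
    using w nondegenerate_left[of "(N ^^ j) w"] H_zero_left by (auto simp: in_V)
  also have "\<dots> \<longleftrightarrow> (N ^^ j) v = 0" using w by (simp add: Npow_gpow gpow_eq_0 in_V)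
  finally show ?thesis .
qed

lemma perp_range_N: "perp (range_N j) = {v \<in> V. (N ^^ j) v = 0}"
  unfolding perp_def using H_range_N_eq_0_iff by auto

lemma perp_image_range_N:
  "perp ((\<lambda>y. y + s y) ` range_N j) = {v \<in> V. (N ^^ j) (v + s v) = 0}"
proof -
  have "(\<forall>x\<in>V. H v ((N ^^ j) x + s ((N ^^ j) x)) = 0) \<longleftrightarrow> (N ^^ j) (v + s v) = 0" if v: "v \<in> V" for v
  proof -
    have "H v ((N ^^ j) x + s ((N ^^ j) x)) = H (v + s v) ((N ^^ j) x)" if "x \<in> V" for x
      using v that by (simp add: H_add_left H_add_right H_s_left in_V)
    then show ?thesis using H_range_N_eq_0_iff[OF add_in_V[OF v s_in_V[OF v]], of j] by simp
  qed
  then show ?thesis unfolding perp_def by blast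
qed

lemma subspace_range_N: "subspace (range_N j)"
  by (rule Npow.subspace_image[OF subspace_V])

lemma range_N_subset: "range_N j \<subseteq> V" by (auto simp: in_V)

lemma s_range_N: "y \<in> range_N j \<Longrightarrow> s y \<in> range_N j"
proof -
  assume "y \<in> range_N j"
  then obtain x where x: "x \<in> V" "y = (N ^^ j) x" by auto
  obtain w where w: "w \<in> V" "s x = (g ^^ j) w" using gpow_surj[OF s_in_V[OF x(1)]] .
  have "(g ^^ j) (s ((N ^^ j) x)) = (g ^^ j) ((N ^^ j) w)"
    using x(1) w by (simp add: Npow_s[symmetric] Npow_gpow)
  then have "s y = (N ^^ j) w" using x w inj_gpow[of j] by (auto simp: inj_on_eq_iff in_V)
  then show ?thesis using w by auto
qed

lemma g_range_N:
  assumes "y \<in> range_N j"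
  shows "g y \<in> range_N j"
proof -
  from assms obtain x where x: "x \<in> V" "y = (N ^^ j) x" by auto
  have "g y = (N ^^ j) (g x)" using Npow_gpow[of j 1 x] x by simp
  then show ?thesis using x by (simp add: in_V)
qed

lemma gpow_range_N: "y \<in> range_N j \<Longrightarrow> (g ^^ i) y \<in> range_N j"
  by (induction i) (auto intro: g_range_N simp del: funpow.simps simp: funpow.simps(2) o_def)

text \<open>
  By duality \<open>(1 + s) N\<^sup>j\<close> and \<open>N\<^sup>j (1 + s) = (1 + g\<^sup>j s) N\<^sup>j\<close> have equally many values on \<open>V\<close>. With
  \<open>j = 2 i + 1\<close>, conjugation by \<open>g\<^sup>i\<close> turns \<open>g s\<close> into \<open>g\<^sup>j s\<close>. For even \<open>j\<close> the element \<open>g\<^sup>j s\<close> would be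
  conjugate to \<open>s\<close> instead, and nothing would follow about \<open>g s\<close>.
\<close>

lemma card_one_plus_s_eq_card_one_plus_gs:
  assumes "odd j"
  shows "card ((\<lambda>y. y + s y) ` range_N j) = card ((\<lambda>y. y + g (s y)) ` range_N j)"
proof -
  let ?E = "range_N j"
  obtain i where i: "j = i + Suc i" using assms by (metis oddE add_Suc_right mult_2 add.commute plus_1_eq_Suc)
  let ?K = "{v \<in> V. (N ^^ j) (v + s v) = 0}"
  let ?X = "(\<lambda>y. y + s y) ` ?E"
  have X: "subspace ?X" "?X \<subseteq> V"
    by (rule subspace_image_linear[OF linear_add[OF linear_id linear_s] subspace_range_N])
       (auto simp: in_V)
  have "card ?X * card ?K = card V"
    using card_mult_card_perp[OF X] unfolding perp_image_range_N .
  moreover have "card ((\<lambda>v. (N ^^ j) (v + s v)) ` V) * card ?K = card V"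
  proof (rule card_linear_image_mult_card_kernel[OF subspace_V order_refl])
    fix x y
    have "x + y + s (x + y) = (x + s x) + (y + s y)" by (simp add: s.add ac_simps)
    then show "(N ^^ j) (x + y + s (x + y)) = (N ^^ j) (x + s x) + (N ^^ j) (y + s y)"
      by (simp only: Npow.add)
  qed
  ultimately have "card ?X * card ?K = card ((\<lambda>v. (N ^^ j) (v + s v)) ` V) * card ?K" by simp
  moreover have "0 \<in> ?K" using subspace_0[OF subspace_V] by simp
  then have "card ?K \<noteq> 0" using finite_V by auto
  ultimately have "card ?X = card ((\<lambda>v. (N ^^ j) (v + s v)) ` V)" by (rule mult_right_cancel[THEN iffD1, rotated])
  also have "(\<lambda>v. (N ^^ j) (v + s v)) ` V = (\<lambda>y. y + (g ^^ j) (s y)) ` ?E"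
    unfolding image_image by (intro image_cong) (simp_all add: Npow.add Npow_s)
  also have "\<dots> = (g ^^ i) ` ((\<lambda>y. y + g (s y)) ` ?E)"
  proof -
    have eq: "(g ^^ i) y + (g ^^ j) (s ((g ^^ i) y)) = (g ^^ i) (y + g (s y))" if "y \<in> ?E" for y
    proof -
      have "(g ^^ j) (s ((g ^^ i) y)) = (g ^^ Suc i) ((g ^^ i) (s ((g ^^ i) y)))"
        unfolding i add.commute[of i] funpow_add by simp
      also have "\<dots> = (g ^^ i) (g (s y))"
        using that by (subst gpow_s_gpow) (auto simp: in_V funpow_swap1)
      finally show ?thesis by (simp add: gpow.add)
    qed
    have "?E = (g ^^ i) ` ?E"
    proof (intro equalityI subsetI)
      fix y assume y: "y \<in> ?E"
      then have yV: "y \<in> V" using range_N_subset by blast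
      have "y = (g ^^ i) (s ((g ^^ i) (s y)))" using gpow_s_gpow[OF s_in_V[OF yV]] s_s[OF yV] by simp
      then show "y \<in> (g ^^ i) ` ?E"
        by (rule image_eqI) (intro s_range_N gpow_range_N y)
    qed (metis imageE gpow_range_N)
    then have "(\<lambda>y. y + (g ^^ j) (s y)) ` ?E = (\<lambda>y. y + (g ^^ j) (s y)) ` (g ^^ i) ` ?E" by (rule arg_cong)
    also have "\<dots> = (g ^^ i) ` ((\<lambda>y. y + g (s y)) ` ?E)"
      unfolding image_image using eq by (intro image_cong) auto
    finally show ?thesis .
  qed
  also have "card \<dots> = card ((\<lambda>y. y + g (s y)) ` ?E)"
    by (intro card_image inj_on_subset[OF inj_gpow]) (auto simp: in_V)
  finally show ?thesis .
qed

text \<open>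
  With \<open>E\<close>, \<open>X\<close>, \<open>Y\<close> and \<open>K\<close> as in the introduction, the proof establishes
  \<open>|X|\<^sup>2 = |N E| |(1 + s) K|\<^sup>2\<close>. The hypothesis \<open>no_block\<close> says that no Jordan block of \<open>g\<close> with
  eigenvalue 1 has size \<open>j\<close>: the block of size \<open>l\<close> contributes to \<open>ker N \<inter> N\<^sup>i V\<close> if and only if
  \<open>i < l\<close>.
\<close>

lemma even_dim_range_N:
  assumes j: "odd j"
    and no_block: "\<And>y. \<lbrakk>y \<in> range_N (j - 1); N y = 0\<rbrakk> \<Longrightarrow> y \<in> range_N j"
  shows "\<exists>d. card (range_N (Suc j)) = CARD('a) ^ (2 * d)"
proof -
  let ?E = "range_N j"
  let ?p = "\<lambda>y. y + s y"
  define K where "K = {y \<in> ?E. N y = 0}"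
  define X where "X = ?p ` ?E"
  define Y where "Y = (\<lambda>y. y + g (s y)) ` ?E"
  define W where "W = {a + b |a b. a \<in> X \<and> b \<in> Y}"
  let ?NE = "range_N (Suc j)"
  note linear_p = linear_add[OF linear_id linear_s]
  interpret p: Vector_Spaces.linear smult smult ?p by (rule linear_p)
  have NE: "?NE = N ` ?E" by (simp add: image_image)
  have E_V: "y \<in> V" if "y \<in> ?E" for y using that range_N_subset by auto
  have X: "subspace X" "X \<subseteq> V"
    unfolding X_def by (rule subspace_image_linear[OF linear_p subspace_range_N]) (auto simp: in_V)
  have Y: "subspace Y" "Y \<subseteq> V"
    unfolding Y_def
    by (rule subspace_image_linear[OF linear_add[OF linear_id] subspace_range_N],
        rule linearI) (auto simp: in_V s.add g.add s.scale g.scale)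
  have K: "subspace K" "K \<subseteq> V"
    using subspace_range_N[of j] range_N_subset
    by (auto simp: K_def N.add N.scale subspace_def)
  have NE_V: "?NE \<subseteq> V" by (rule range_N_subset)

  \<comment> \<open>The two involutions differ by \<open>N s\<close>, so \<open>Y\<close> may be replaced by \<open>N E\<close>, whose complement is known.\<close>
  have W_eq: "W = {a + b |a b. a \<in> X \<and> b \<in> ?NE}"
  proof (intro equalityI subsetI)
    fix w assume "w \<in> W"
    then obtain y y' where y: "y \<in> ?E" "y' \<in> ?E" "w = ?p y + (y' + g (s y'))"
      unfolding W_def X_def Y_def by blast
    have "w = ?p (y + y') + N (s y')" unfolding y(3) by (simp add: N_def s.add ac_simps)
    moreover have "y + y' \<in> ?E" "s y' \<in> ?E"
      using y subspace_add[OF subspace_range_N] s_range_N by blast+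
    ultimately show "w \<in> {a + b |a b. a \<in> X \<and> b \<in> ?NE}" unfolding X_def NE by blast
  next
    fix w assume "w \<in> {a + b |a b. a \<in> X \<and> b \<in> ?NE}"
    then obtain y y' where y: "y \<in> ?E" "y' \<in> ?E" "w = ?p y + N y'"
      unfolding X_def NE by blast
    have "w = ?p (y + s y') + (s y' + g (s (s y')))"
      unfolding y(3) using E_V[OF y(2)] by (simp add: N_def s.add s_s ac_simps)
    moreover have "y + s y' \<in> ?E" "s y' \<in> ?E"
      using y subspace_add[OF subspace_range_N] s_range_N by blast+
    ultimately show "w \<in> W" unfolding W_def X_def Y_def by blast
  qed

  define Z where "Z = {y \<in> K. ?p y = 0}"
  have card_K: "card (?p ` K) * card Z = card K"
    unfolding Z_def by (rule card_linear_image_mult_card_kernel[OF K]) (rule p.add)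
  have card_E: "card ?NE * card K = card ?E"
    unfolding NE K_def
    by (rule card_linear_image_mult_card_kernel[OF subspace_range_N range_N_subset]) (rule N.add)
  have "subspace W" "W \<subseteq> V"
    unfolding W_def using X Y subspace_sums[of X Y] by (auto simp: in_V subset_iff)
  then have card_W: "card W * card (perp W) = card V" by (rule card_mult_card_perp)
  define P where "P = {v \<in> V. (N ^^ j) (?p v) = 0 \<and> (N ^^ Suc j) v = 0}"
  have "perp W = perp X \<inter> perp ?NE"
    unfolding W_eq by (rule perp_sum[OF X subspace_range_N NE_V])
  also have "\<dots> = P"
    unfolding P_def X_def perp_image_range_N perp_range_N by auto
  finally have perp_W: "perp W = P" .
  have sub_P: "subspace P" "P \<subseteq> V"
    using subspace_V unfolding P_def subspace_def
    by (auto simp: p.add p.scale Npow.add Npow.scale N.add N.scale s.add s.scale scale_right_distrib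
          add_eq_0_iff_eq)
  have Npow_p: "(N ^^ j) (?p v) = ?p ((N ^^ j) v)" if "v \<in> V" "N ((N ^^ j) v) = 0" for v
  proof -
    let ?y = "(N ^^ j) v"
    have "N (s ?y) = 0" using that by (simp add: N_s in_V)
    then have "g (s ?y) = s ?y" by (simp add: N_def add_eq_0_iff_eq)
    then have "(g ^^ i) (s ?y) = s ?y" for i by (induction i) auto
    then show ?thesis using that by (simp add: Npow.add Npow_s)
  qed
  \<comment> \<open>\<open>N\<^sup>j\<close> maps the complement of \<open>X + Y\<close> onto the fixed points of \<open>s\<close> in \<open>K\<close>, with kernel \<open>ker N\<^sup>j\<close>.\<close>
  have "(N ^^ j) ` P = Z"
    unfolding P_def Z_def K_def using Npow_p by auto
  moreover have "{v \<in> P. (N ^^ j) v = 0} = {v \<in> V. (N ^^ j) v = 0}"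
    unfolding P_def by (auto simp: Npow.add Npow_s)
  ultimately have "card Z * card {v \<in> V. (N ^^ j) v = 0} = card P"
    using card_linear_image_mult_card_kernel[OF sub_P, of "N ^^ j"] by (simp add: Npow.add)
  moreover have "card ?E * card {v \<in> V. (N ^^ j) v = 0} = card V"
    by (rule card_linear_image_mult_card_kernel[OF subspace_V order_refl]) (rule Npow.add)
  moreover have "card {v \<in> V. (N ^^ j) v = 0} \<noteq> 0"
    using finite_V subspace_0[OF subspace_V] by (auto intro!: exI[of _ 0])
  ultimately have "card W * card Z = card ?E"
    using card_W unfolding perp_W
    by (metis (no_types, lifting) mult.assoc mult_right_cancel)
  moreover have pos: "card U \<noteq> 0" if "subspace U" "U \<subseteq> V" for U
    using that finite_V subspace_0 by (metis card_0_eq empty_iff finite_subset)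
  then have "card Z \<noteq> 0" using card_K K by (metis mult_0_right)
  ultimately have "card W = card ?NE * card (?p ` K)"
    using card_E card_K by (metis (no_types, lifting) mult.assoc mult_right_cancel)

  moreover have "X \<inter> Y = ?p ` K"
  proof (intro equalityI subsetI)
    fix v assume "v \<in> X \<inter> Y"
    then obtain u w where u: "u \<in> ?E" "v = u + s u" and w: "w \<in> ?E" "v = w + g (s w)"
      unfolding X_def Y_def by blast
    have E': "\<exists>y'\<in>range_N (j - 1). y = N y'" if "y \<in> ?E" for y
      using that j by (cases j) auto
    from E'[OF u(1)] E'[OF w(1)] obtain u' w' where
      u': "u' \<in> range_N (j - 1)" "u = N u'" and w': "w' \<in> range_N (j - 1)" "w = N w'" by blast
    have V: "u' \<in> V" "w' \<in> V" using u' w' range_N_subset by blast+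
    \<comment> \<open>Lift \<open>v\<close> through \<open>N\<close> along both presentations, using \<open>(1 + s) N = N (1 + s g)\<close> and
      \<open>(1 + g s) N = N (1 + s)\<close>. The lifts differ by an element \<open>c\<close> of \<open>ker N\<close>, which \<open>no_block\<close> puts into \<open>K\<close>; applying
      \<open>1 + s g\<close> to the equation of the lifts yields \<open>v = (1 + s) c\<close>.\<close>
    define c where "c = (u' + s (g u')) + ?p w'"
    have v1: "v = N (u' + s (g u'))" using u u' V by (simp add: s_N N.add)
    have v2: "v = N (?p w')" using w w' V by (simp add: N_s N.add)
    have Nc: "N c = 0" unfolding c_def N.add[of "u' + s (g u')"] v1[symmetric] v2[symmetric] by simp
    have "c \<in> range_N (j - 1)" unfolding c_def
      using u'(1) w'(1) by (intro subspace_add[OF subspace_range_N] s_range_N g_range_N)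
    with Nc no_block have cK: "c \<in> K" by (simp add: K_def)
    have gc: "g c = c" using Nc by (simp add: N_def add_eq_0_iff_eq)
    have sv: "s v = v" using u E_V by (simp add: s.add s_s add.commute)
    have w'_eq: "?p w' = c + (u' + s (g u'))" by (simp add: c_def ac_simps)
    have "v = s v" using sv by simp
    also have "\<dots> = s (N (?p w'))" using v2 by simp
    also have "\<dots> = ?p w' + s (g (?p w'))" using V by (simp add: N_def s.add g.add s_s ac_simps)
    also have "\<dots> = (c + (u' + s (g u'))) + s (g (c + (u' + s (g u'))))"
      unfolding w'_eq[symmetric] ..
    also have "\<dots> = ?p c"
      using V by (simp add: s.add g.add gc s_g_s_g ac_simps)
    finally show "v \<in> ?p ` K" using cK by blast
  next
    fix v assume "v \<in> ?p ` K"
    then obtain c where c: "c \<in> ?E" "N c = 0" "v = ?p c" by (auto simp: K_def)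
    have "N (s c) = 0" using c E_V by (simp add: N_s)
    then have "g (s c) = s c" by (simp add: N_def add_eq_0_iff_eq)
    then have "v = c + g (s c)" using c by simp
    then show "v \<in> X \<inter> Y" using c unfolding X_def Y_def by blast
  qed
  moreover have "card W * card (X \<inter> Y) = card X * card Y"
    unfolding W_def by (rule card_sum_mult_card_Int[OF X Y])
  moreover have "card X = card Y"
    unfolding X_def Y_def by (rule card_one_plus_s_eq_card_one_plus_gs[OF j])
  ultimately have sq: "card ?NE * (card (?p ` K))\<^sup>2 = (card X)\<^sup>2" by (simp add: power2_eq_square)

  have pK: "subspace (?p ` K)" "?p ` K \<subseteq> V"
    using K by (auto intro!: subspace_image_linear[OF linear_p] in_V)
  obtain a b c where abc: "card ?NE = CARD('a) ^ a" "card (?p ` K) = CARD('a) ^ b" "card X = CARD('a) ^ c"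
    using card_subspace_power[OF subspace_range_N NE_V] card_subspace_power[OF pK] card_subspace_power[OF X]
    by blast
  have "CARD('a) ^ (a + b * 2) = CARD('a) ^ (c * 2)"
    using sq unfolding abc by (simp add: power_add power_mult)
  then have "a + b * 2 = c * 2" using card_field_gt_1[where 'a = 'a] by simp
  then have "a = 2 * (c - b)" by simp
  then show ?thesis using abc(1) by blast
qed

lemma card_kernel_in_range_N:
  "card {y \<in> range_N i. N y = 0} * card {v \<in> V. (N ^^ i) v = 0} = card {v \<in> V. (N ^^ Suc i) v = 0}"
proof -
  let ?U = "{v \<in> V. (N ^^ Suc i) v = 0}"
  have "subspace ?U"
    using subspace_V by (auto simp: subspace_def Npow.add Npow.scale N.add N.scale)
  then have "card ((N ^^ i) ` ?U) * card {v \<in> ?U. (N ^^ i) v = 0} = card ?U"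
    by (rule card_linear_image_mult_card_kernel) (auto simp: Npow.add)
  moreover have "(N ^^ i) ` ?U = {y \<in> range_N i. N y = 0}" by auto
  moreover have "{v \<in> ?U. (N ^^ i) v = 0} = {v \<in> V. (N ^^ i) v = 0}" by auto
  ultimately show ?thesis by simp
qed

text \<open>
  If \<open>D i\<close> is the dimension of \<open>ker N\<^sup>i\<close>, then \<open>D (i + 1) - D i\<close> counts the Jordan blocks of size
  greater than \<open>i\<close>. The hypothesis \<open>no_block\<close> therefore states that none has size exactly \<open>j\<close>.
\<close>

lemma even_corank:
  assumes D: "\<And>i. card {v \<in> V. (N ^^ i) v = 0} = CARD('a) ^ D i" and V: "card V = CARD('a) ^ n"
    and j: "odd j" and no_block: "D (Suc j) + D (j - 1) = 2 * D j"
  shows "\<exists>d. n = D (Suc j) + 2 * d"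
proof -
  let ?K = "\<lambda>i. {y \<in> range_N i. N y = 0}"
  have Q: "CARD('a) > 1" by (rule card_field_gt_1)
  have K: "card (?K i) * CARD('a) ^ D i = CARD('a) ^ D (Suc i)" for i
    using card_kernel_in_range_N[of i] unfolding D .
  have "card (?K (j - 1)) * CARD('a) ^ (D (j - 1) + D (Suc j)) = CARD('a) ^ D j * CARD('a) ^ D (Suc j)"
    using K[of "j - 1"] odd_pos[OF j] by (simp add: power_add)
  also have "\<dots> = card (?K j) * CARD('a) ^ (2 * D j)"
    using K[of j] by (simp add: mult_2 power_add)
  finally have "card (?K (j - 1)) = card (?K j)"
    using no_block Q by (simp add: add.commute)
  moreover have sub: "?K j \<subseteq> ?K (j - 1)"
  proof
    fix y assume y: "y \<in> ?K j"
    then obtain x where "x \<in> V" "y = (N ^^ j) x" by auto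
    moreover obtain i where "j = Suc i" using odd_pos[OF j] gr0_conv_Suc by blast
    ultimately have "y = (N ^^ (j - 1)) (N x)" "N x \<in> V" by (simp_all add: funpow_swap1 in_V)
    then have "y \<in> range_N (j - 1)" by (rule image_eqI)
    then show "y \<in> ?K (j - 1)" using y by simp
  qed
  moreover have "finite (?K (j - 1))" using finite_V by auto
  ultimately have K_eq: "?K j = ?K (j - 1)" by (simp only: card_subset_eq)
  have "y \<in> range_N j" if "y \<in> range_N (j - 1)" "N y = 0" for y
  proof -
    have "y \<in> ?K (j - 1)" using that by (intro CollectI conjI)
    then have "y \<in> ?K j" unfolding K_eq .
    then show ?thesis by simp
  qed
  from even_dim_range_N[OF j this]
  obtain d where d: "card (range_N (Suc j)) = CARD('a) ^ (2 * d)" by blast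
  have "card (range_N (Suc j)) * card {v \<in> V. (N ^^ Suc j) v = 0} = card V"
    by (rule card_linear_image_mult_card_kernel[OF subspace_V order_refl]) (rule Npow.add)
  then have "CARD('a) ^ (2 * d + D (Suc j)) = CARD('a) ^ n" unfolding d D V by (simp add: power_add)
  then show ?thesis using Q by (intro exI[of _ d]) simp
qed

end

section \<open>Dimensions of generalized eigenspaces\<close>

text \<open>
  Unique coordinates with respect to a finite basis of the kernel.
\<close>

lemma card_mat_kernel:
  fixes A :: "'a :: {field, finite} mat"
  assumes A: "A \<in> carrier_mat nr nc"
  shows "card (mat_kernel A) = CARD('a) ^ kernel_dim A"
proof -
  interpret K: kernel nr nc A by unfold_locales (rule A)
  have sub: "mat_kernel A \<subseteq> carrier_vec nc" using A by (auto simp: mat_kernel_def)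
  obtain B where B: "finite B" "K.basis B" using kernel_basis_exists[OF A] by auto
  then have Bk: "B \<subseteq> mat_kernel A" and indpt: "K.lin_indpt B" and span: "K.span B = mat_kernel A"
    by (auto simp: K.Ker.basis_def)
  have Bc: "B \<subseteq> carrier_vec nc" using Bk sub by auto
  have idx: "K.lincomb a B $ i = (\<Sum>x\<in>B. a x * x $ i)" if "i < nc" for a i
    by (rule K.lincomb_index[OF that Bk])
  have lc: "K.lincomb a B \<in> mat_kernel A" for a
    using K.Ker.lincomb_closed[of B a] Bk by auto
  have "bij_betw (\<lambda>a. K.lincomb a B) (B \<rightarrow>\<^sub>E UNIV) (mat_kernel A)"
    unfolding bij_betw_def
  proof (intro conjI inj_onI)
    fix a b :: "'a vec \<Rightarrow> 'a"
    assume ab: "a \<in> B \<rightarrow>\<^sub>E UNIV" "b \<in> B \<rightarrow>\<^sub>E UNIV" and eq: "K.lincomb a B = K.lincomb b B"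
    have "K.lincomb (\<lambda>x. a x - b x) B = 0\<^sub>v nc"
    proof (rule eq_vecI)
      fix i assume "i < dim_vec (0\<^sub>v nc :: 'a vec)"
      then have i: "i < nc" by simp
      then show "K.lincomb (\<lambda>x. a x - b x) B $ i = 0\<^sub>v nc $ i"
        using arg_cong[OF eq, of "\<lambda>v. v $ i"]
        by (simp add: idx left_diff_distrib sum_subtractf)
    qed (use lc sub in \<open>auto simp: subset_iff\<close>)
    then have "(\<lambda>x. a x - b x) \<in> B \<rightarrow> {0}"
      using K.Ker.not_lindepD[OF indpt B(1), of "\<lambda>x. a x - b x"] by auto
    then have "a x = b x" if "x \<in> B" for x using that by auto
    then show "a = b" using ab by (auto intro: PiE_ext)
  next
    show "(\<lambda>a. K.lincomb a B) ` (B \<rightarrow>\<^sub>E UNIV) = mat_kernel A"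
    proof (intro equalityI subsetI)
      fix v assume "v \<in> mat_kernel A"
      then have "v \<in> K.span B" using span by simp
      then obtain a where a: "v = K.lincomb a B"
        using K.Ker.finite_in_span[OF B(1), of v] Bk by auto
      also have "K.lincomb a B = K.lincomb (restrict a B) B"
      proof (rule eq_vecI)
        have "dim_vec (K.lincomb c B) = nc" for c using lc sub by (auto simp: subset_iff)
        then show "dim_vec (K.lincomb a B) = dim_vec (K.lincomb (restrict a B) B)"
          "\<And>i. i < dim_vec (K.lincomb (restrict a B) B) \<Longrightarrow> K.lincomb a B $ i = K.lincomb (restrict a B) B $ i"
          by (auto simp: idx)
      qed
      finally show "v \<in> (\<lambda>a. K.lincomb a B) ` (B \<rightarrow>\<^sub>E UNIV)" by (intro image_eqI[of _ _ "restrict a B"]) auto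
    qed (use lc in auto)
  qed
  then have "card (mat_kernel A) = card (B \<rightarrow>\<^sub>E (UNIV :: 'a set))" by (simp add: bij_betw_same_card)
  also have "\<dots> = CARD('a) ^ card B" using B(1) by (simp add: card_PiE)
  also have "card B = kernel_dim A" using K.Ker.dim_basis[OF B] by simp
  finally show ?thesis .
qed

lemma kernel_dim_pow_eq_0:
  fixes C :: "'a :: field mat"
  assumes C: "C \<in> carrier_mat m m"
    and inj: "\<And>v. \<lbrakk>v \<in> carrier_vec m; C *\<^sub>v v = 0\<^sub>v m\<rbrakk> \<Longrightarrow> v = 0\<^sub>v m"
  shows "kernel_dim (C ^\<^sub>m i) = 0"
proof -
  have pow: "C ^\<^sub>m i \<in> carrier_mat m m" using C by simp
  have "det C \<noteq> 0" using inj det_0_iff_vec_prod_zero_field[OF C] by blast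
  moreover have "det (C ^\<^sub>m i) = det C ^ i"
  proof (induction i)
    case (Suc i)
    then show ?case using C det_mult[of "C ^\<^sub>m i" m C] by simp
  qed (use C in simp)
  ultimately have "det (C ^\<^sub>m i) \<noteq> 0" by simp
  then obtain D where D: "D \<in> carrier_mat m m" "D * C ^\<^sub>m i = 1\<^sub>m m"
    using det_non_zero_imp_unit[OF pow, of "()"] by (auto simp: Units_def ring_mat_simps)
  have "mat_kernel (C ^\<^sub>m i) = mat_kernel (1\<^sub>m m)"
    using mat_kernel_mult_eq[OF one_carrier_mat pow D] by (simp only: right_mult_one_mat[OF pow])
  then show ?thesis
    unfolding kernel_dim_def carrier_matD(2)[OF pow] by (simp add: kernel_one_mat(1))
qed

lemma dim_gen_eigenspace_four_block:
  fixes A B :: "'a :: field mat" and ev :: 'a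
  assumes A: "A \<in> carrier_mat n n" and B: "B \<in> carrier_mat m m"
  shows "dim_gen_eigenspace (four_block_mat A (0\<^sub>m n m) (0\<^sub>m m n) B) ev k
    = dim_gen_eigenspace A ev k + dim_gen_eigenspace B ev k"
proof -
  let ?M = "four_block_mat A (0\<^sub>m n m) (0\<^sub>m m n) B"
  have "char_matrix ?M ev = four_block_mat (char_matrix A ev) (0\<^sub>m n m) (0\<^sub>m m n) (char_matrix B ev)"
    using A B unfolding char_matrix_def by (intro eq_matI) auto
  then have "char_matrix ?M ev ^\<^sub>m k
      = four_block_mat (char_matrix A ev ^\<^sub>m k) (0\<^sub>m n m) (0\<^sub>m m n) (char_matrix B ev ^\<^sub>m k)"
    using A B by (simp add: pow_four_block_mat)
  moreover have "char_matrix A ev ^\<^sub>m k \<in> carrier_mat n n" "char_matrix B ev ^\<^sub>m k \<in> carrier_mat m m"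
    using A B by simp_all
  moreover have "char_matrix ?M ev ^\<^sub>m k \<in> carrier_mat (n + m) (n + m)"
    using four_block_carrier_mat[OF A B] by simp
  ultimately show ?thesis
    unfolding dim_gen_eigenspace_def kernel_dim_def
    using kernel_four_block_0_mat[of "char_matrix ?M ev ^\<^sub>m k"] by (metis carrier_matD(2))
qed

lemma dim_gen_eigenspace_eq_0:
  fixes B :: "'a :: field mat"
  assumes B: "B \<in> carrier_mat m m" and ev: "\<not> eigenvalue B a"
  shows "dim_gen_eigenspace B a k = 0"
  unfolding dim_gen_eigenspace_def using B ev eigenvalue_char_matrix[OF B]
  by (intro kernel_dim_pow_eq_0[of _ m]) auto

lemma dim_gen_eigenspace_elementary_divisors:
  assumes "elementary_divisor_partition A a \<mu>"
  shows "dim_gen_eigenspace A a i = (\<Sum>k\<in>#\<mu>. min i k)"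
proof -
  obtain ks m B where ks: "mset ks = \<mu>" and B: "B \<in> carrier_mat m m" "\<not> eigenvalue B a"
    and sim: "similar_mat A (diag_block_mat [jordan_matrix (map (\<lambda>k. (k, a)) ks), B])"
    using assms unfolding elementary_divisor_partition_def by blast
  let ?J = "jordan_matrix (map (\<lambda>k. (k, a)) ks)"
  have J: "?J \<in> carrier_mat (sum_list ks) (sum_list ks)"
    using jordan_matrix_carrier[of "map (\<lambda>k. (k, a)) ks"] by (simp add: o_def)
  have "diag_block_mat [?J, B] = four_block_mat ?J (0\<^sub>m (sum_list ks) m) (0\<^sub>m m (sum_list ks)) B"
    unfolding diag_block_mat.simps(2)[of ?J "[B]"] diag_block_mat_singleton Let_def
    using J B by (simp add: o_def)
  then have "dim_gen_eigenspace A a i = dim_gen_eigenspace ?J a i"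
    using dim_gen_eigenspace_similar[OF sim] dim_gen_eigenspace_four_block[OF J B(1)]
      dim_gen_eigenspace_eq_0[OF B] by simp
  also have "\<dots> = (\<Sum>k\<leftarrow>ks. min i k)"
    by (simp add: dim_gen_eigenspace_jordan_matrix filter_map o_def)
  also have "\<dots> = (\<Sum>k\<in>#\<mu>. min i k)" by (metis ks mset_map sum_mset_sum_list)
  finally show ?thesis .
qed

section \<open>Coordinate spaces and the standard Hermitian form\<close>

text \<open>
  Vectors of length \<open>n\<close> are represented by functions that vanish from \<open>n\<close> on, so that vectors of all
  lengths live in one additive group and the abstract counting results apply.
\<close>

definition fun_scale :: "'a :: field \<Rightarrow> (nat \<Rightarrow> 'a) \<Rightarrow> nat \<Rightarrow> 'a" where
  "fun_scale c f = (\<lambda>i. c * f i)"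

definition coord_space :: "nat \<Rightarrow> (nat \<Rightarrow> 'a :: field) set" where
  "coord_space n = {f. \<forall>i\<ge>n. f i = 0}"

definition mat_op :: "'a :: field mat \<Rightarrow> (nat \<Rightarrow> 'a) \<Rightarrow> nat \<Rightarrow> 'a" where
  "mat_op A f = (\<lambda>i. if i < dim_row A then \<Sum>j<dim_col A. A $$ (i, j) * f j else 0)"

definition hermitian_form :: "nat \<Rightarrow> nat \<Rightarrow> (nat \<Rightarrow> 'a :: field) \<Rightarrow> (nat \<Rightarrow> 'a) \<Rightarrow> 'a" where
  "hermitian_form q n f h = (\<Sum>i<n. f i ^ q * h i)"

lemma bij_betw_coord_space:
  "bij_betw (\<lambda>f. restrict f {..<n}) (coord_space n) ({..<n} \<rightarrow>\<^sub>E (UNIV :: 'a :: field set))"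
  by (rule bij_betw_byWitness[where f' = "\<lambda>f i. if i < n then f i else 0"])
     (auto simp: coord_space_def PiE_def extensional_def fun_eq_iff)

lemma card_coord_space: "card (coord_space n :: (nat \<Rightarrow> 'a :: {field, finite}) set) = CARD('a) ^ n"
  using bij_betw_same_card[OF bij_betw_coord_space[of n, where 'a = 'a]] by (simp add: card_PiE)

lemma finite_coord_space: "finite (coord_space n :: (nat \<Rightarrow> 'a :: {field, finite}) set)"
  using bij_betw_finite[OF bij_betw_coord_space[of n, where 'a = 'a]] by (simp add: finite_PiE)

lemma vector_space_fun_scale: "vector_space (fun_scale :: 'a :: field \<Rightarrow> _)"
  by unfold_locales (auto simp: fun_scale_def fun_eq_iff algebra_simps)

lemma linear_mat_op: "Vector_Spaces.linear fun_scale fun_scale (mat_op A)"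
  unfolding Vector_Spaces.linear_iff
  by (simp add: vector_space_fun_scale)
     (auto simp: fun_scale_def mat_op_def fun_eq_iff algebra_simps sum.distrib sum_distrib_left)

lemma mat_op_in_coord_space: "A \<in> carrier_mat n n \<Longrightarrow> mat_op A f \<in> coord_space n"
  by (auto simp: mat_op_def coord_space_def)

lemma mat_op_mult:
  assumes "A \<in> carrier_mat n n" "B \<in> carrier_mat n n"
  shows "mat_op (A * B) f = mat_op A (mat_op B f)"
proof
  fix i
  show "mat_op (A * B) f i = mat_op A (mat_op B f) i"
  proof (cases "i < n")
    case True
    have "mat_op (A * B) f i = (\<Sum>j<n. (\<Sum>k<n. A $$ (i, k) * B $$ (k, j)) * f j)"
      using assms True by (simp add: mat_op_def scalar_prod_def atLeast0LessThan)
    also have "\<dots> = (\<Sum>j<n. \<Sum>k<n. A $$ (i, k) * B $$ (k, j) * f j)"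
      by (simp add: sum_distrib_right)
    also have "\<dots> = (\<Sum>k<n. \<Sum>j<n. A $$ (i, k) * B $$ (k, j) * f j)" by (rule sum.swap)
    also have "\<dots> = mat_op A (mat_op B f) i"
      using assms True by (simp add: mat_op_def sum_distrib_left mult.assoc)
    finally show ?thesis .
  qed (use assms in \<open>simp add: mat_op_def\<close>)
qed

lemma mat_op_one: "f \<in> coord_space n \<Longrightarrow> mat_op (1\<^sub>m n) f = f"
proof
  fix i assume f: "f \<in> coord_space n"
  have "(\<Sum>j<n. 1\<^sub>m n $$ (i, j) * f j) = (\<Sum>j<n. if i = j then f j else 0)" if "i < n"
    using that by (intro sum.cong) auto
  then show "mat_op (1\<^sub>m n) f i = f i" using f by (auto simp: mat_op_def coord_space_def)
qed

lemma card_kernel_mat_op: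
  assumes A: "A \<in> carrier_mat n n"
  shows "card {f \<in> coord_space n. mat_op A f = 0} = card (mat_kernel A)"
proof (rule bij_betw_same_card)
  have mult: "(A *\<^sub>v vec n f = 0\<^sub>v n) = (mat_op A f = 0)" for f
    using A by (auto simp: vec_eq_iff fun_eq_iff mat_op_def scalar_prod_def atLeast0LessThan)
  have coord: "vec n (\<lambda>i. if i < n then v $ i else 0) = v" if "v \<in> carrier_vec n" for v :: "'a vec"
    using that by (auto simp: vec_eq_iff)
  show "bij_betw (vec n) {f \<in> coord_space n. mat_op A f = 0} (mat_kernel A)"
  proof (rule bij_betw_byWitness[where f' = "\<lambda>v i. if i < n then v $ i else 0"])
    show "vec n ` {f \<in> coord_space n. mat_op A f = 0} \<subseteq> mat_kernel A"
      using A mult by (auto simp: mat_kernel_def)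
    show "(\<lambda>v i. if i < n then v $ i else 0) ` mat_kernel A \<subseteq> {f \<in> coord_space n. mat_op A f = 0}"
    proof
      fix f assume "f \<in> (\<lambda>v i. if i < n then v $ i else 0) ` mat_kernel A"
      then obtain v where v: "v \<in> mat_kernel A" and f: "f = (\<lambda>i. if i < n then v $ i else 0)" by auto
      have "vec n f = v" unfolding f using v A coord by (auto simp: mat_kernel_def)
      then show "f \<in> {f \<in> coord_space n. mat_op A f = 0}"
        using v A mult[of f] by (auto simp: mat_kernel_def f coord_space_def)
    qed
  qed (use A coord in \<open>auto simp: coord_space_def mat_kernel_def fun_eq_iff\<close>)
qed

lemma power_sum_card:
  assumes p: "prime p" "q = p ^ m" "CARD('a :: {field, finite}) = q ^ 2" and "finite I"
  shows "(\<Sum>i\<in>I. f i :: 'a) ^ q = (\<Sum>i\<in>I. f i ^ q)"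
proof -
  have "q > 0" using p by (simp add: prime_gt_0_nat)
  with \<open>finite I\<close> show ?thesis
    by (induction I rule: finite_induct) (simp_all add: power_card_prime_power_add[OF p])
qed

text \<open>
  The characteristic is a prime that divides the order of the field.
\<close>

lemma two_eq_0_field_card_power_2:
  assumes "CARD('a :: {field, finite}) = (2 ^ m) ^ 2"
  shows "(1 :: 'a) + 1 = 0"
proof -
  have "CHAR('a) > 0" by (rule finite_imp_CHAR_pos) auto
  then have pr: "prime CHAR('a)" by (rule prime_CHAR_semidom)
  have "CHAR('a) dvd 2 ^ (m * 2)" using CHAR_dvd_CARD[where 'a = 'a] assms by (simp add: power_mult)
  with pr have "CHAR('a) = 2" by (metis prime_dvd_power primes_dvd_imp_eq two_is_prime_nat)
  then show ?thesis using of_nat_CHAR[where 'a = 'a] by simp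
qed

lemma finite_sesquilinear_space_hermitian_form:
  assumes p: "prime p" "q = p ^ m" "CARD('a :: {field, finite}) = q ^ 2"
  shows "finite_sesquilinear_space fun_scale (coord_space n)
    (hermitian_form q n :: (nat \<Rightarrow> 'a) \<Rightarrow> _) (\<lambda>c. c ^ q)"
proof -
  have q0: "q > 0" using p by (simp add: prime_gt_0_nat)
  note add = power_card_prime_power_add[OF p]
  interpret vector_space "fun_scale :: 'a \<Rightarrow> _" by (rule vector_space_fun_scale)
  let ?e = "\<lambda>j i. if i = (j :: nat) then 1 else 0 :: 'a"
  have e: "?e j \<in> coord_space n" if "j < n" for j using that by (auto simp: coord_space_def)
  have He: "hermitian_form q n f (?e j) = f j ^ q" "hermitian_form q n (?e j) f = f j"
    if "j < n" for f and j
    using that q0 by (auto simp: hermitian_form_def if_distrib[of "\<lambda>x. _ * x"]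
        if_distrib[of "\<lambda>x. x * _"] if_distrib[of "\<lambda>x. x ^ _"] zero_power cong: if_cong)
  show ?thesis
  proof unfold_locales
    show "subspace (coord_space n :: (nat \<Rightarrow> 'a) set)"
      by (auto simp: subspace_def coord_space_def fun_scale_def)
    show "finite (coord_space n :: (nat \<Rightarrow> 'a) set)" by (rule finite_coord_space)
    have "inj (\<lambda>c :: 'a. c ^ q)"
    proof (rule injI)
      fix c d :: 'a assume "c ^ q = d ^ q"
      moreover have "c ^ q = (c - d) ^ q + d ^ q" using add[of "c - d" d] by simp
      ultimately show "c = d" by simp
    qed
    then show "surj (\<lambda>c :: 'a. c ^ q)" by (rule finite_UNIV_inj_surj[rotated]) simp
  next
    fix f :: "nat \<Rightarrow> 'a"
    assume f: "f \<in> coord_space n" and *: "\<And>h. h \<in> coord_space n \<Longrightarrow> hermitian_form q n f h = 0"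
    have "f j = 0" for j
    proof (cases "j < n")
      case True
      then show ?thesis using *[OF e] He(1)[of j f] q0 by simp
    qed (use f in \<open>simp add: coord_space_def\<close>)
    then show "f = 0" by auto
  next
    fix f :: "nat \<Rightarrow> 'a"
    assume f: "f \<in> coord_space n" and *: "\<And>h. h \<in> coord_space n \<Longrightarrow> hermitian_form q n h f = 0"
    have "f j = 0" for j
    proof (cases "j < n")
      case True
      then show ?thesis using *[OF e] He(2)[of j f] by simp
    qed (use f in \<open>simp add: coord_space_def\<close>)
    then show "f = 0" by auto
  qed (auto simp: hermitian_form_def fun_scale_def add algebra_simps sum.distrib
        sum_distrib_left power_mult_distrib)
qed

text \<open>
  The defining equation of the unitary group says that the columns of \<open>g\<close> are orthonormal.
\<close>

lemma hermitian_form_unitary: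
  fixes g :: "'a :: {field, finite} mat"
  assumes p: "prime p" "q = p ^ m" "CARD('a) = q ^ 2"
    and g: "g \<in> carrier_mat n n" "transpose_mat (bar_mat q g) * g = 1\<^sub>m n"
    and h: "h \<in> coord_space n"
  shows "hermitian_form q n (mat_op g f) (mat_op g h) = hermitian_form q n f h"
proof -
  have entry: "(\<Sum>i<n. (g $$ (i, j)) ^ q * g $$ (i, k)) = 1\<^sub>m n $$ (j, k)" if "j < n" "k < n" for j k
    using arg_cong[OF g(2), of "\<lambda>A. A $$ (j, k)"] g(1) that
    by (simp add: bar_mat_def scalar_prod_def atLeast0LessThan)
  have "hermitian_form q n (mat_op g f) (mat_op g h) =
    (\<Sum>i<n. (\<Sum>j<n. (g $$ (i, j)) ^ q * f j ^ q) * (\<Sum>k<n. g $$ (i, k) * h k))"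
    using g(1) by (simp add: hermitian_form_def mat_op_def power_sum_card[OF p] power_mult_distrib)
  also have "\<dots> = (\<Sum>i<n. \<Sum>j<n. \<Sum>k<n. f j ^ q * ((g $$ (i, j)) ^ q * g $$ (i, k) * h k))"
    unfolding sum_product by (intro sum.cong refl) (simp add: ac_simps)
  also have "\<dots> = (\<Sum>j<n. \<Sum>i<n. \<Sum>k<n. f j ^ q * ((g $$ (i, j)) ^ q * g $$ (i, k) * h k))"
    by (rule sum.swap)
  also have "\<dots> = (\<Sum>j<n. \<Sum>k<n. \<Sum>i<n. f j ^ q * ((g $$ (i, j)) ^ q * g $$ (i, k) * h k))"
    by (intro sum.cong refl sum.swap)
  also have "\<dots> = (\<Sum>j<n. f j ^ q * (\<Sum>k<n. 1\<^sub>m n $$ (j, k) * h k))"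
    by (simp add: sum_distrib_left[symmetric] sum_distrib_right[symmetric] entry)
  also have "\<dots> = (\<Sum>j<n. f j ^ q * mat_op (1\<^sub>m n) h j)" by (simp add: mat_op_def)
  also have "\<dots> = hermitian_form q n f h" unfolding mat_op_one[OF h] hermitian_form_def ..
  finally show ?thesis .
qed

section \<open>Strongly real unitary elements\<close>

text \<open>
  The sum is the dimension of \<open>ker (g - 1)\<^sup>j\<^sup>+\<^sup>1\<close>, so the conclusion is that \<open>(g - 1)\<^sup>j\<^sup>+\<^sup>1\<close> has even rank.
  This rank includes the part of the space on which \<open>g - 1\<close> is invertible; its dimension is
  controlled by choosing \<open>j\<close> larger than all parts.
\<close>

lemma strongly_real_imp_even_corank:
  fixes g :: "'a :: {field, finite} mat"
  assumes q: "q = 2 ^ m" "CARD('a) = q ^ 2"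
    and g: "g \<in> carrier (unitary_group n q)" and real: "strongly_real (unitary_group n q) g"
    and \<mu>: "elementary_divisor_partition g 1 \<mu>"
    and j: "odd j" "j \<notin># \<mu>"
  shows "\<exists>d. n = (\<Sum>k\<in>#\<mu>. min (Suc j) k) + 2 * d"
proof -
  note p = two_is_prime_nat q
  let ?U = "unitary_group n q :: 'a mat monoid"
  interpret U: group ?U by (rule unitary_group_group[OF p])
  have U_mult: "x \<otimes>\<^bsub>?U\<^esub> y = x * y" "\<one>\<^bsub>?U\<^esub> = 1\<^sub>m n" for x y
    by (simp_all add: unitary_group_def units_of_mult units_of_one ring_mat_simps)
  have U_carrier: "x \<in> carrier_mat n n" "transpose_mat (bar_mat q x) * x = 1\<^sub>m n" if "x \<in> carrier ?U" for x
    using that by (auto simp: unitary_group_def units_of_carrier Units_def ring_mat_simps)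
  obtain s where s: "s \<in> carrier ?U" "s * s = 1\<^sub>m n" "s * g * s = inv\<^bsub>?U\<^esub> g"
    using real by (auto simp: strongly_real_def U_mult)
  note g' = U_carrier[OF g] and s' = U_carrier[OF s(1)]
  have sg: "s * g \<in> carrier_mat n n" and gsg_carrier: "g * (s * g) \<in> carrier_mat n n"
    using g'(1) s'(1) by auto
  have "1\<^sub>m n = (s * g * s) * g" using U.l_inv[OF g] unfolding U_mult s(3) ..
  also have "\<dots> = (s * g) * (s * g)" by (rule assoc_mult_mat[OF sg s'(1) g'(1)])
  also have "\<dots> = s * (g * (s * g))" by (rule assoc_mult_mat[OF s'(1) g'(1) sg])
  finally have "s * 1\<^sub>m n = s * (s * (g * (s * g)))" by (rule arg_cong)
  also have "\<dots> = (s * s) * (g * (s * g))" by (rule assoc_mult_mat[symmetric, OF s'(1) s'(1) gsg_carrier])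
  also have "\<dots> = g * (s * g)" unfolding s(2) by (rule left_mult_one_mat[OF gsg_carrier])
  finally have gsg: "g * (s * g) = s" unfolding right_mult_one_mat[OF s'(1)] ..
  let ?V = "coord_space n :: (nat \<Rightarrow> 'a) set"
  have two: "(1 :: 'a) + 1 = 0" using q by (intro two_eq_0_field_card_power_2) simp
  interpret F: finite_sesquilinear_space "fun_scale :: 'a \<Rightarrow> _" ?V "hermitian_form q n" "\<lambda>c. c ^ q"
    by (rule finite_sesquilinear_space_hermitian_form[OF p])
  interpret R: reversed_isometry "fun_scale :: 'a \<Rightarrow> _" ?V "hermitian_form q n" "\<lambda>c. c ^ q"
    "mat_op g" "mat_op s"
  proof (rule reversed_isometry.intro[OF F.finite_sesquilinear_space_axioms], rule reversed_isometry_axioms.intro)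
    fix f assume f: "f \<in> ?V"
    show "mat_op s (mat_op s f) = f"
      using mat_op_mult[OF s'(1) s'(1)] s(2) mat_op_one[OF f] by simp
    show "mat_op g (mat_op s (mat_op g f)) = mat_op s f"
      using mat_op_mult[OF g'(1) mult_carrier_mat[OF s'(1) g'(1)], of f] mat_op_mult[OF s'(1) g'(1), of f]
      by (simp add: gsg)
  qed (simp_all only: two linear_mat_op mat_op_in_coord_space[OF g'(1)] mat_op_in_coord_space[OF s'(1)]
        hermitian_form_unitary[OF p g'] hermitian_form_unitary[OF p s'])
  define M where "M = char_matrix g 1"
  have M: "M \<in> carrier_mat n n" using g' by (simp add: M_def)
  have "(- 1 :: 'a) = 1" using two by (simp add: minus_unique)
  then have M_entry: "M $$ (i, j) = g $$ (i, j) + 1\<^sub>m n $$ (i, j)" if "i < n" "j < n" for i j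
    using g'(1) that by (simp add: M_def char_matrix_def)
  have N_eq: "R.N f = mat_op M f" if f: "f \<in> ?V" for f
  proof -
    have "mat_op M f = mat_op g f + mat_op (1\<^sub>m n) f"
      using g'(1) M by (auto simp: mat_op_def fun_eq_iff M_entry distrib_right sum.distrib simp del: index_one_mat(1))
    then show ?thesis by (simp add: R.N_def mat_op_one[OF f])
  qed
  have Npow_eq: "(R.N ^^ i) f = mat_op (M ^\<^sub>m i) f" if f: "f \<in> ?V" for f i
    using f
  proof (induction i arbitrary: f)
    case 0
    then show ?case using M by (simp add: mat_op_one)
  next
    case (Suc i)
    have "(R.N ^^ Suc i) f = (R.N ^^ i) (R.N f)" by (simp add: funpow_swap1)
    also have "\<dots> = mat_op (M ^\<^sub>m i) (mat_op M f)"
      using Suc R.N_in_V[of f] by (simp add: N_eq)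
    also have "\<dots> = mat_op (M ^\<^sub>m Suc i) f" using M by (simp add: mat_op_mult[of _ n])
    finally show ?case .
  qed
  let ?D = "\<lambda>i. \<Sum>k\<in>#\<mu>. min i k"
  have "card {v \<in> ?V. (R.N ^^ i) v = 0} = CARD('a) ^ ?D i" for i
  proof -
    have Mi: "M ^\<^sub>m i \<in> carrier_mat n n" using M by simp
    have "{v \<in> ?V. (R.N ^^ i) v = 0} = {v \<in> ?V. mat_op (M ^\<^sub>m i) v = 0}" by (auto simp: Npow_eq)
    then show ?thesis
      using card_kernel_mat_op[OF Mi] card_mat_kernel[OF Mi] dim_gen_eigenspace_elementary_divisors[OF \<mu>, of i]
      by (simp add: dim_gen_eigenspace_def flip: M_def)
  qed
  moreover have "card ?V = CARD('a) ^ n" by (rule card_coord_space)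
  moreover have "?D (Suc j) + ?D (j - 1) = 2 * ?D j"
  proof -
    have "min (Suc j) k + min (j - 1) k = 2 * min j k" if "k \<in># \<mu>" for k
      using that j odd_pos[OF j(1)] by (cases "k < j"; cases "k = j") (auto simp: min_def)
    then have "(\<Sum>k\<in>#\<mu>. min (Suc j) k + min (j - 1) k) = (\<Sum>k\<in>#\<mu>. 2 * min j k)"
      by (intro arg_cong[of _ _ sum_mset] image_mset_cong) auto
    then show ?thesis by (simp add: sum_mset.distrib sum_mset_distrib_left image_mset.compositionality o_def)
  qed
  ultimately show ?thesis by (rule R.even_corank[OF _ _ j(1)])
qed

lemma odd_sum_mset_iff:
  fixes f :: "nat \<Rightarrow> nat"
  assumes "\<And>k. k \<in># \<mu> \<Longrightarrow> odd (f k) \<longleftrightarrow> odd k"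
  shows "odd (\<Sum>k\<in>#\<mu>. f k) \<longleftrightarrow> odd (size (odd_parts \<mu>))"
  using assms by (induction \<mu>) auto

text \<open>
  Both cases of the main result are instances of these hypotheses: the odd parts, an odd number of
  them, are all larger than the even parts. That \<open>k \<ge> 3\<close> makes \<open>k - 2\<close> a positive odd number, to
  which the parity of the rank of \<open>(g - 1)\<^sup>k\<^sup>-\<^sup>1\<close> applies.
\<close>

lemma not_strongly_real_of_odd_gap:
  fixes g :: "'a :: {field, finite} mat"
  assumes q: "q = 2 ^ m" "CARD('a) = q ^ 2"
    and g: "g \<in> carrier (unitary_group n q)"
    and \<mu>: "elementary_divisor_partition g 1 \<mu>"
    and odd_size: "odd (size (odd_parts \<mu>))"
    and k: "odd k" "k \<ge> 3"
    and odd_ge: "\<And>l. \<lbrakk>l \<in># \<mu>; odd l\<rbrakk> \<Longrightarrow> k \<le> l"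
    and even_less: "\<And>l. \<lbrakk>l \<in># \<mu>; even l\<rbrakk> \<Longrightarrow> l < k"
  shows "\<not> strongly_real (unitary_group n q) g"
proof
  assume real: "strongly_real (unitary_group n q) g"
  note even_corank = strongly_real_imp_even_corank[OF q g real \<mu>]
  let ?D = "\<lambda>i. \<Sum>l\<in>#\<mu>. min i l"
  \<comment> \<open>Any odd number beyond all parts will do.\<close>
  define L where "L = 2 * sum_mset \<mu> + 1"
  have odd_L: "odd L" unfolding L_def by presburger
  have le_L: "l < L" if "l \<in># \<mu>" for l
    using that by (auto simp: L_def dest!: multi_member_split)
  obtain d where d: "n = ?D (k - 1) + 2 * d"
  proof -
    have "Suc (k - 2) = k - 1" "odd (k - 2)" "k - 2 \<notin># \<mu>" using k odd_ge[of "k - 2"] by auto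
    with even_corank[of "k - 2"] that show ?thesis by auto
  qed
  obtain d' where d': "n = ?D (Suc L) + 2 * d'"
    using even_corank[OF odd_L] le_L[of L] by auto
  \<comment> \<open>As \<open>L\<close> exceeds all parts, the left-hand side is just the sum of the parts.\<close>
  have "?D (Suc L) = (\<Sum>l\<in>#\<mu>. min (k - 1) l + (l - (k - 1)))"
    using le_L by (intro arg_cong[of _ _ sum_mset] image_mset_cong) fastforce
  then have "?D (Suc L) = ?D (k - 1) + (\<Sum>l\<in>#\<mu>. l - (k - 1))" by (simp add: sum_mset.distrib)
  with d d' have "even (\<Sum>l\<in>#\<mu>. l - (k - 1))" by presburger
  moreover have "odd (l - (k - 1)) \<longleftrightarrow> odd l" if "l \<in># \<mu>" for l
    using odd_ge[OF that] even_less[OF that] k by (cases "odd l") auto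
  ultimately show False using odd_sum_mset_iff[of \<mu> "\<lambda>l. l - (k - 1)"] odd_size by simp
qed

theorem proposition6p5:
  fixes g :: "'a :: {field, finite} mat" and n q m :: nat and \<mu> :: "nat multiset"
  assumes "m \<ge> 1" and "q = 2 ^ m" and "CARD('a) = q ^ 2"
    and "g \<in> carrier (unitary_group n q)"
    and "elementary_divisor_partition g 1 \<mu>"
    and "(odd (size (odd_parts \<mu>)) \<and>
          int (smallest_odd_part \<mu>) - int (largest_even_part \<mu>) \<ge> 3)
       \<or> (\<exists>k. odd_parts \<mu> = {#k#} \<and> k \<ge> 3 \<and>
              int k - int (largest_even_part \<mu>) = 1 \<and> count \<mu> (largest_even_part \<mu>) = 1)"
  shows "\<not> strongly_real (unitary_group n q) g"
proof -
  let ?k = "smallest_odd_part \<mu>"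
  have *: "odd (size (odd_parts \<mu>)) \<and> ?k \<ge> 3 \<and> largest_even_part \<mu> < ?k"
    using assms(6)
  proof (elim disjE exE conjE)
    fix k assume odd_parts: "odd_parts \<mu> = {#k#}" and gap: "int k - int (largest_even_part \<mu>) = 1" "k \<ge> 3"
    have "?k = k" unfolding smallest_odd_part_def odd_parts by simp
    with gap show ?thesis by (simp add: odd_parts)
  qed simp
  then have "odd_parts \<mu> \<noteq> {#}" by (metis even_zero size_empty)
  then have "?k \<in> set_mset (odd_parts \<mu>)"
    unfolding smallest_odd_part_def by (intro Min_in) (simp_all only: set_mset_eq_empty_iff finite_set_mset not_False_eq_True)
  moreover have "?k \<le> l" if "l \<in># \<mu>" "odd l" for l
    using that unfolding smallest_odd_part_def by (intro Min_le) auto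
  moreover have "l < ?k" if "l \<in># \<mu>" "even l" for l
  proof -
    have l: "l \<in># even_parts \<mu>" using that by simp
    then have "even_parts \<mu> \<noteq> {#}" by (metis empty_iff set_mset_empty)
    then have "largest_even_part \<mu> = Max (set_mset (even_parts \<mu>))"
      unfolding largest_even_part_def by (rule if_not_P)
    then have "l \<le> largest_even_part \<mu>" using Max_ge[OF finite_set_mset l] by (simp only:)
    with * show ?thesis by simp
  qed
  ultimately show ?thesis using * assms(2-5) by (intro not_strongly_real_of_odd_gap[of q m g n \<mu> ?k]) auto
qed

end
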